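(* Let $P=(X,\prec)$ be a finite poset and let $t\ge 1$ be an integer. Then $$\Omega_{\mathbf q}(P,t)^2\ \geqslant_{\mathbf q}\ \Omega_{\mathbf q}(P,t-1)\cdot\Omega_{\mathbf q}(P,t+1).$$ More generally, for all integers $a,b\ge 1$, $$\Omega_{\mathbf q}(P,t+a)\cdot\Omega_{\mathbf q}(P,t+b)\ \geqslant_{\mathbf q}\ \Omega_{\mathbf q}(P,t)\cdot\Omega_{\mathbf q}(P,t+a+b).$$
   Context: Write $X=\{x_1,\dots,x_n\}$, labeled so that $x_i\mapsto i$ is a linear extension of $P$ (natural labeling), and let $\mathbf q=(q_1,\dots,q_n)$ be variables. For an integer $s\ge 0$, $\mathrm{PP}(P,s)$ is the set of maps $T:X\to\{0,1,\dots,s\}$ with $T(x)\le T(y)$ whenever $x\prec y$, and $$\Omega_{\mathbf q}(P,s):=\sum_{T\in\mathrm{PP}(P,s)}q_1^{T(x_1)}\cdots q_n^{T(x_n)}.$$ For $F,G\in\mathbb R[q_1,\dots,q_n]$, $F\geqslant_{\mathbf q}G$ means that all coefficients of $F-G$ are nonnegative. *)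

theory Defs
  imports Complex_Main "HOL-Library.Poly_Mapping" "HOL-Library.FuncSet"
begin

text \<open>Real polynomials as finitely supported maps from exponent vectors to coefficients. The
  variables are indexed by all natural numbers; the polynomials below only involve those indexed by
  \<open>1, \<dots>, n\<close>, so that their coefficients are the ones in the polynomial ring in \<open>n\<close> variables.\<close>

type_synonym mpoly_real = "(nat \<Rightarrow>\<^sub>0 nat) \<Rightarrow>\<^sub>0 real"

definition qvar :: "nat \<Rightarrow> mpoly_real" where
  "qvar i = Poly_Mapping.single (Poly_Mapping.single i 1) 1"

definition coeff_ge :: "mpoly_real \<Rightarrow> mpoly_real \<Rightarrow> bool"  (infix \<open>\<ge>\<^sub>q\<close> 50) where
  "F \<ge>\<^sub>q G \<longleftrightarrow> (\<forall>m. Poly_Mapping.lookup (F - G) m \<ge> 0)"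

text \<open>The order \<open>prec\<close> is strict and only its restriction to the carrier \<open>X\<close> is relevant.\<close>

definition finite_poset :: "'a set \<Rightarrow> ('a \<Rightarrow> 'a \<Rightarrow> bool) \<Rightarrow> bool" where
  "finite_poset X prec \<longleftrightarrow> finite X \<and> irreflp_on X prec \<and> transp_on X prec"

definition natural_labeling ::
    "'a set \<Rightarrow> ('a \<Rightarrow> 'a \<Rightarrow> bool) \<Rightarrow> nat \<Rightarrow> (nat \<Rightarrow> 'a) \<Rightarrow> bool" where
  "natural_labeling X prec n x \<longleftrightarrow>
     bij_betw x {1..n} X \<and> (\<forall>i\<in>{1..n}. \<forall>j\<in>{1..n}. prec (x i) (x j) \<longrightarrow> i < j)"

text \<open>Maps are taken to be extensional, so that each map on \<open>X\<close> is counted once.\<close>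

definition PP :: "'a set \<Rightarrow> ('a \<Rightarrow> 'a \<Rightarrow> bool) \<Rightarrow> nat \<Rightarrow> ('a \<Rightarrow> nat) set" where
  "PP X prec s = {T \<in> X \<rightarrow>\<^sub>E {0..s}. \<forall>x\<in>X. \<forall>y\<in>X. prec x y \<longrightarrow> T x \<le> T y}"

definition Omega_q ::
    "'a set \<Rightarrow> ('a \<Rightarrow> 'a \<Rightarrow> bool) \<Rightarrow> nat \<Rightarrow> (nat \<Rightarrow> 'a) \<Rightarrow> nat \<Rightarrow> mpoly_real" where
  "Omega_q X prec n x s = (\<Sum>T\<in>PP X prec s. \<Prod>i=1..n. qvar i ^ T (x i))"

end

theory Submission
  imports Defs
begin

text \<open>
  The coefficient of \<open>q\<^sup>m\<close> in \<open>\<Omega>(P,s) \<cdot> \<Omega>(P,s')\<close> is the number of pairs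
  \<open>(T,U) \<in> PP(P,s) \<times> PP(P,s')\<close> with \<open>T + U = m\<close>. So the claim is \<open>card K \<le> card L\<close> for each
  \<open>m\<close>, where \<open>K\<close> consists of the pairs for the bounds \<open>(t, t+a+b)\<close> and \<open>L\<close> of those for
  the bounds \<open>(t+a, t+b)\<close>. Two pairs \<open>(T,U)\<close>, \<open>(T',U')\<close> of \<open>K\<close> produce the pair
  \<open>(max(T, U'-b), min(U, T'+b))\<close>
  of \<open>L\<close>, with subtraction truncated at \<open>0\<close>: both maps are order preserving, they obey the bounds \<open>t+a\<close> and \<open>t+b\<close>, and the
  sum is still \<open>m\<close> because \<open>T + U = T' + U'\<close>. Exchanging the roles of the two pairs gives a second
  element \<open>(max(T', U-b), min(U', T+b))\<close> of \<open>L\<close>.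

  Now \<open>max(T, U'-b) + b\<close> and \<open>min(U', T+b)\<close> are the join and the meet of \<open>T+b\<close> and \<open>U'\<close>
  in the distributive lattice of maps from \<open>X\<close> to the natural numbers. So the joins of the
  \<open>T+b\<close> with the \<open>U'\<close> are first components, shifted by \<open>b\<close>, of elements of \<open>L\<close>, and the meets
  are second components of elements of \<open>L\<close>. As \<open>m\<close> is fixed, a pair is determined by either of
  its components, and Daykin's inequality
  \<open>card A \<cdot> card B \<le> card (A \<squnion> B) \<cdot> card (A \<sqinter> B)\<close> for finite subsets \<open>A\<close>, \<open>B\<close> of a
  distributive lattice gives \<open>(card K)\<^sup>2 \<le> (card L)\<^sup>2\<close>.

  Daykin's inequality is the case of indicator functions in the four functions theorem of Ahlswede
  and Daykin. It is proved for lattices of sets; maps become sets by passing to the region below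
  their graph.
\<close>

section \<open>The four functions theorem\<close>

text \<open>
  The theorem for a one-element ground set. If \<open>c1\<close> and \<open>d0\<close> are positive, the outer hypotheses
  bound \<open>c0\<close> and \<open>d1\<close> from below, and what remains is
  \<open>p + q \<le> r + p q / r\<close> for \<open>p = a0 b1\<close>, \<open>q = a1 b0\<close>, \<open>r = c1 d0\<close>, that is,
  \<open>(r - p) (r - q) \<ge> 0\<close>.
\<close>

lemma four_numbers:
  fixes a0 a1 b0 b1 c0 c1 d0 d1 :: "'a :: linordered_field"
  assumes nonneg: "a0 \<ge> 0" "a1 \<ge> 0" "b0 \<ge> 0" "b1 \<ge> 0" "c0 \<ge> 0" "c1 \<ge> 0" "d0 \<ge> 0" "d1 \<ge> 0"
    and h00: "a0 * b0 \<le> c0 * d0" and h01: "a0 * b1 \<le> c1 * d0"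
    and h10: "a1 * b0 \<le> c1 * d0" and h11: "a1 * b1 \<le> c1 * d1"
  shows "(a0 + a1) * (b0 + b1) \<le> (c0 + c1) * (d0 + d1)"
proof (cases "c1 * d0 = 0")
  case True
  have "0 \<le> a0 * b1" "0 \<le> a1 * b0" using nonneg by simp_all
  with True have "a0 * b1 = 0" "a1 * b0 = 0" using h01 h10 by linarith+
  moreover have "0 \<le> c0 * d1" using nonneg by simp
  ultimately have "a0 * b0 + a0 * b1 + a1 * b0 + a1 * b1 \<le> c0 * d0 + c0 * d1 + c1 * d0 + c1 * d1"
    using h00 h11 True by linarith
  then show ?thesis by (simp add: algebra_simps)
next
  case False
  define r where "r = c1 * d0"
  have r: "r > 0" using False nonneg unfolding r_def by (simp add: less_le)
  have "(a0 * b1) * (a1 * b0) = (a0 * b0) * (a1 * b1)" by (simp add: ac_simps)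
  also have "\<dots> \<le> (c0 * d0) * (c1 * d1)"
    using mult_mono[OF h00 h11] nonneg by simp
  also have "\<dots> = r * (c0 * d1)" by (simp add: r_def ac_simps)
  finally have outer: "(a0 * b1) * (a1 * b0) \<le> r * (c0 * d1)" .
  have "0 \<le> (r - a0 * b1) * (r - a1 * b0)"
    using h01 h10 by (intro mult_nonneg_nonneg) (auto simp: r_def)
  with outer have "r * (a0 * b1 + a1 * b0) \<le> r * (r + c0 * d1)"
    by (simp add: algebra_simps)
  then have "a0 * b1 + a1 * b0 \<le> r + c0 * d1"
    using r by simp
  then show ?thesis using h00 h11 by (simp add: r_def algebra_simps)
qed

lemma sum_Pow_insert:
  fixes f :: "'a set \<Rightarrow> 'b :: comm_monoid_add"
  assumes "finite S" "x \<notin> S"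
  shows "sum f (Pow (insert x S)) = (\<Sum>A\<in>Pow S. f A + f (insert x A))"
proof -
  have disj: "Pow S \<inter> insert x ` Pow S = {}" using assms(2) by auto
  have inj: "inj_on (insert x) (Pow S)"
    using assms(2) by (meson PowD inj_onI insert_ident subsetD)
  show ?thesis
    using assms(1) disj inj
    by (simp add: Pow_insert sum.union_disjoint sum.reindex sum.distrib)
qed

text \<open>
  Summing out one element \<open>x\<close> of the ground set turns \<open>f\<close> into \<open>\<lambda>A. f A + f (insert x A)\<close>, and
  \<open>four_numbers\<close> says that this preserves the hypothesis.
\<close>

theorem four_functions:
  fixes \<alpha> \<beta> \<gamma> \<delta> :: "'a set \<Rightarrow> 'b :: linordered_field"
  assumes "finite S"
    and "\<And>A. \<alpha> A \<ge> 0" "\<And>A. \<beta> A \<ge> 0" "\<And>A. \<gamma> A \<ge> 0" "\<And>A. \<delta> A \<ge> 0"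
    and "\<And>A B. A \<subseteq> S \<Longrightarrow> B \<subseteq> S \<Longrightarrow> \<alpha> A * \<beta> B \<le> \<gamma> (A \<union> B) * \<delta> (A \<inter> B)"
  shows "sum \<alpha> (Pow S) * sum \<beta> (Pow S) \<le> sum \<gamma> (Pow S) * sum \<delta> (Pow S)"
  using assms
proof (induction S arbitrary: \<alpha> \<beta> \<gamma> \<delta> rule: finite_induct)
  case empty
  from empty.prems(5)[of "{}" "{}"] show ?case by simp
next
  case (insert x S)
  let ?e = "\<lambda>f A. f A + f (insert x A) :: 'b"
  have "sum (?e \<alpha>) (Pow S) * sum (?e \<beta>) (Pow S) \<le> sum (?e \<gamma>) (Pow S) * sum (?e \<delta>) (Pow S)"
  proof (rule insert.IH)
    fix A B assume AB: "A \<subseteq> S" "B \<subseteq> S"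
    then have notin: "x \<notin> A" "x \<notin> B" using insert.hyps by auto
    have sub: "A \<subseteq> insert x S" "B \<subseteq> insert x S"
      "insert x A \<subseteq> insert x S" "insert x B \<subseteq> insert x S" using AB by auto
    show "?e \<alpha> A * ?e \<beta> B \<le> ?e \<gamma> (A \<union> B) * ?e \<delta> (A \<inter> B)"
      using insert.prems(5)[OF sub(1,2)] insert.prems(5)[OF sub(1,4)]
        insert.prems(5)[OF sub(3,2)] insert.prems(5)[OF sub(3,4)] notin
      by (intro four_numbers insert.prems(1-4)) simp_all
  qed (simp_all add: insert.prems(1-4))
  then show ?case
    using insert.hyps by (simp add: sum_Pow_insert)
qed

corollary daykin_inequality:
  assumes S: "finite S" and AS: "\<A> \<subseteq> Pow S" and BS: "\<B> \<subseteq> Pow S"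
    and join: "\<And>A B. A \<in> \<A> \<Longrightarrow> B \<in> \<B> \<Longrightarrow> A \<union> B \<in> \<C>"
    and meet: "\<And>A B. A \<in> \<A> \<Longrightarrow> B \<in> \<B> \<Longrightarrow> A \<inter> B \<in> \<D>"
    and fin: "finite \<C>" "finite \<D>"
  shows "card \<A> * card \<B> \<le> card \<C> * card \<D>"
proof -
  let ?i = "\<lambda>\<F> A. of_bool (A \<in> \<F>) :: rat"
  have card: "sum (?i \<F>) (Pow S) = of_nat (card (\<F> \<inter> Pow S))" for \<F>
    using S by (simp add: Int_commute)
  have "sum (?i \<A>) (Pow S) * sum (?i \<B>) (Pow S) \<le> sum (?i \<C>) (Pow S) * sum (?i \<D>) (Pow S)"
    using S by (rule four_functions) (auto simp: join meet)
  then have "card (\<A> \<inter> Pow S) * card (\<B> \<inter> Pow S) \<le> card (\<C> \<inter> Pow S) * card (\<D> \<inter> Pow S)"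
    unfolding card of_nat_mult[symmetric] of_nat_le_iff .
  also have "\<dots> \<le> card \<C> * card \<D>"
    using fin by (intro mult_le_mono card_mono) auto
  finally show ?thesis
    using AS BS by (simp add: Int_absorb2)
qed

section \<open>Maps as regions below their graph\<close>

definition below_graph :: "'a set \<Rightarrow> ('a \<Rightarrow> nat) \<Rightarrow> ('a \<times> nat) set" where
  "below_graph X S = (SIGMA x:X. {..<S x})"

lemma below_graph_eq_iff:
  "below_graph X S = below_graph X S' \<longleftrightarrow> (\<forall>x\<in>X. S x = S' x)"
proof
  assume eq: "below_graph X S = below_graph X S'"
  have "{..<S x} = {..<S' x}" if "x \<in> X" for x
  proof -
    have "{k. (x, k) \<in> below_graph X S} = {k. (x, k) \<in> below_graph X S'}"
      by (simp only: eq)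
    with that show ?thesis by (simp add: below_graph_def lessThan_def)
  qed
  then show "\<forall>x\<in>X. S x = S' x" by simp
next
  assume "\<forall>x\<in>X. S x = S' x"
  then show "below_graph X S = below_graph X S'"
    unfolding below_graph_def by (intro Sigma_cong) simp_all
qed

lemma below_graph_Un:
  "below_graph X S \<union> below_graph X S' = below_graph X (\<lambda>x. max (S x) (S' x))"
  by (auto simp: below_graph_def)

lemma below_graph_Int:
  "below_graph X S \<inter> below_graph X S' = below_graph X (\<lambda>x. min (S x) (S' x))"
  by (auto simp: below_graph_def)

lemma below_graph_subset:
  "(\<And>x. x \<in> X \<Longrightarrow> S x \<le> N) \<Longrightarrow> below_graph X S \<subseteq> X \<times> {..<N}"
  by (force simp: below_graph_def)

section \<open>Pairs of order preserving maps with prescribed sum\<close>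

definition PP_pairs ::
    "'a set \<Rightarrow> ('a \<Rightarrow> 'a \<Rightarrow> bool) \<Rightarrow> ('a \<Rightarrow> nat) \<Rightarrow> nat \<Rightarrow> nat \<Rightarrow> (('a \<Rightarrow> nat) \<times> ('a \<Rightarrow> nat)) set" where
  "PP_pairs X prec M s s' =
     {(T, U). T \<in> PP X prec s \<and> U \<in> PP X prec s' \<and> (\<forall>y\<in>X. T y + U y = M y)}"

lemma finite_PP: "finite X \<Longrightarrow> finite (PP X prec s)"
  by (rule finite_subset[of _ "X \<rightarrow>\<^sub>E {0..s}"]) (auto simp: PP_def intro: finite_PiE)

lemma finite_PP_pairs: "finite X \<Longrightarrow> finite (PP_pairs X prec M s s')"
  by (rule finite_subset[of _ "PP X prec s \<times> PP X prec s'"])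
    (auto simp: PP_pairs_def finite_PP)

lemma PP_le: "T \<in> PP X prec s \<Longrightarrow> y \<in> X \<Longrightarrow> T y \<le> s"
  by (auto simp: PP_def)

lemma restrict_in_PP_iff:
  "(\<lambda>y\<in>X. f y) \<in> PP X prec s \<longleftrightarrow>
     (\<forall>y\<in>X. f y \<le> s) \<and> (\<forall>x\<in>X. \<forall>y\<in>X. prec x y \<longrightarrow> f x \<le> f y)"
  by (auto simp: PP_def Pi_def)

lemma PP_eqI:
  "T \<in> PP X prec s \<Longrightarrow> T' \<in> PP X prec s \<Longrightarrow> (\<And>y. y \<in> X \<Longrightarrow> T y = T' y) \<Longrightarrow> T = T'"
  by (rule PiE_ext[of T X "\<lambda>_. {0..s}"]) (simp_all add: PP_def)

lemma PP_pairs_eqI: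
  assumes P: "(T, U) \<in> PP_pairs X prec M s s'" and P': "(T', U') \<in> PP_pairs X prec M s s'"
    and eq: "\<And>y. y \<in> X \<Longrightarrow> T y = T' y \<or> U y = U' y"
  shows "T = T' \<and> U = U'"
proof -
  have both: "T y = T' y \<and> U y = U' y" if "y \<in> X" for y
  proof -
    have "T y + U y = T' y + U' y" using P P' that by (simp add: PP_pairs_def)
    then show ?thesis using eq[OF that] by linarith
  qed
  have "T = T'"
    by (rule PP_eqI[of T X prec s]) (use P P' both in \<open>simp_all add: PP_pairs_def\<close>)
  moreover have "U = U'"
    by (rule PP_eqI[of U X prec s']) (use P P' both in \<open>simp_all add: PP_pairs_def\<close>)
  ultimately show ?thesis by simp
qed

lemma inj_on_below_graph_fst:
  "inj_on (\<lambda>(T, U). below_graph X (\<lambda>y. T y + b)) (PP_pairs X prec M s s')"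
proof (rule inj_onI, unfold split_paired_all prod.case)
  fix T U T' U'
  assume P: "(T, U) \<in> PP_pairs X prec M s s'" "(T', U') \<in> PP_pairs X prec M s s'"
    and "below_graph X (\<lambda>y. T y + b) = below_graph X (\<lambda>y. T' y + b)"
  then have "\<forall>y\<in>X. T y = T' y"
    by (simp add: below_graph_eq_iff)
  then show "(T, U) = (T', U')"
    using PP_pairs_eqI[OF P] by blast
qed

lemma inj_on_below_graph_snd:
  "inj_on (\<lambda>(T, U). below_graph X U) (PP_pairs X prec M s s')"
proof (rule inj_onI, unfold split_paired_all prod.case)
  fix T U T' U'
  assume P: "(T, U) \<in> PP_pairs X prec M s s'" "(T', U') \<in> PP_pairs X prec M s s'"
    and "below_graph X U = below_graph X U'"
  then have "\<forall>y\<in>X. U y = U' y"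
    by (simp add: below_graph_eq_iff)
  then show "(T, U) = (T', U')"
    using PP_pairs_eqI[OF P] by blast
qed

text \<open>
  The exchange that moves the bounds \<open>(t, t+a+b)\<close> to \<open>(t+a, t+b)\<close>. As \<open>T + U = T' + U'\<close>,
  the inequality \<open>T \<ge> U' - b\<close> holds exactly where \<open>U \<le> T' + b\<close> does. So the pair takes the
  values of \<open>(T, U)\<close> there and those of \<open>(U' - b, T' + b)\<close> elsewhere, and both have sum \<open>M\<close>.
\<close>

lemma PP_pairs_exchange:
  assumes P: "(T, U) \<in> PP_pairs X prec M t (t + a + b)"
    and P': "(T', U') \<in> PP_pairs X prec M t (t + a + b)"
  shows "(\<lambda>y\<in>X. max (T y) (U' y - b), \<lambda>y\<in>X. min (U y) (T' y + b))
           \<in> PP_pairs X prec M (t + a) (t + b)"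
proof -
  have mono: "T x \<le> T y" "U x \<le> U y" "T' x \<le> T' y" "U' x \<le> U' y"
    if "x \<in> X" "y \<in> X" "prec x y" for x y
    using P P' that by (auto simp: PP_pairs_def PP_def)
  have bound: "T y \<le> t" "T' y \<le> t" "U' y \<le> t + a + b" if "y \<in> X" for y
    using P P' that by (auto simp: PP_pairs_def dest: PP_le)
  have sum: "T y + U y = M y" "T' y + U' y = M y" if "y \<in> X" for y
    using P P' that by (auto simp: PP_pairs_def)
  have "(\<lambda>y\<in>X. max (T y) (U' y - b)) \<in> PP X prec (t + a)"
    unfolding restrict_in_PP_iff
  proof (intro conjI ballI impI)
    show "max (T y) (U' y - b) \<le> t + a" if "y \<in> X" for y
      using bound[OF that] by simp
    show "max (T x) (U' x - b) \<le> max (T y) (U' y - b)" if "x \<in> X" "y \<in> X" "prec x y" for x y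
      using mono[OF that] by linarith
  qed
  moreover have "(\<lambda>y\<in>X. min (U y) (T' y + b)) \<in> PP X prec (t + b)"
    unfolding restrict_in_PP_iff
  proof (intro conjI ballI impI)
    show "min (U y) (T' y + b) \<le> t + b" if "y \<in> X" for y
      using bound[OF that] by simp
    show "min (U x) (T' x + b) \<le> min (U y) (T' y + b)" if "x \<in> X" "y \<in> X" "prec x y" for x y
      using mono[OF that] by linarith
  qed
  moreover have "max (T y) (U' y - b) + min (U y) (T' y + b) = M y" if "y \<in> X" for y
    using sum[OF that] by linarith
  ultimately show ?thesis by (simp add: PP_pairs_def)
qed

lemma card_PP_pairs_le:
  assumes X: "finite X"
  shows "card (PP_pairs X prec M t (t + a + b)) \<le> card (PP_pairs X prec M (t + a) (t + b))"
proof -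
  let ?K = "PP_pairs X prec M t (t + a + b)" and ?L = "PP_pairs X prec M (t + a) (t + b)"
  let ?f = "\<lambda>(T :: 'a \<Rightarrow> nat, U :: 'a \<Rightarrow> nat). below_graph X (\<lambda>y. T y + b)"
  let ?g = "\<lambda>(T :: 'a \<Rightarrow> nat, U :: 'a \<Rightarrow> nat). below_graph X U"
  have "card (?f ` ?K) * card (?g ` ?K) \<le> card (?f ` ?L) * card (?g ` ?L)"
  proof (rule daykin_inequality)
    show "finite (X \<times> {..<t + a + b})" using X by simp
    have "T y + b \<le> t + a + b \<and> U y \<le> t + a + b" if "(T, U) \<in> ?K" "y \<in> X" for T U y
      using that PP_le[of T X prec t y] PP_le[of U X prec "t + a + b" y]
      by (simp add: PP_pairs_def)
    then show "?f ` ?K \<subseteq> Pow (X \<times> {..<t + a + b})" "?g ` ?K \<subseteq> Pow (X \<times> {..<t + a + b})"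
      by (fastforce intro!: below_graph_subset)+
  next
    fix A B assume "A \<in> ?f ` ?K" "B \<in> ?g ` ?K"
    then obtain T U T' U' where P: "(T, U) \<in> ?K" "(T', U') \<in> ?K"
      and A: "A = below_graph X (\<lambda>y. T y + b)" and B: "B = below_graph X U'"
      by auto
    have "A \<union> B = ?f (\<lambda>y\<in>X. max (T y) (U' y - b), \<lambda>y\<in>X. min (U y) (T' y + b))"
      unfolding A B below_graph_Un prod.case below_graph_eq_iff by auto
    then show "A \<union> B \<in> ?f ` ?L"
      by (simp only: imageI[OF PP_pairs_exchange[OF P]])
    have "A \<inter> B = ?g (\<lambda>y\<in>X. max (T' y) (U y - b), \<lambda>y\<in>X. min (U' y) (T y + b))"
      unfolding A B below_graph_Int prod.case below_graph_eq_iff by auto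
    then show "A \<inter> B \<in> ?g ` ?L"
      by (simp only: imageI[OF PP_pairs_exchange[OF P(2,1)]])
  qed (use X in \<open>simp_all add: finite_PP_pairs\<close>)
  then have "(card ?K)\<^sup>2 \<le> (card ?L)\<^sup>2"
    by (simp only: card_image[OF inj_on_below_graph_fst] card_image[OF inj_on_below_graph_snd]
        power2_eq_square)
  then show ?thesis by (simp only: power2_nat_le_eq_le)
qed

section \<open>Coefficients of products of multivariate order polynomials\<close>

definition label_exponent :: "nat \<Rightarrow> (nat \<Rightarrow> 'a) \<Rightarrow> ('a \<Rightarrow> nat) \<Rightarrow> nat \<Rightarrow>\<^sub>0 nat" where
  "label_exponent n x T = (\<Sum>i=1..n. Poly_Mapping.single i (T (x i)))"

lemma qvar_power: "qvar i ^ k = Poly_Mapping.single (Poly_Mapping.single i k) 1"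
  by (induction k) (simp_all add: qvar_def mult_single single_add[symmetric])

lemma prod_qvar_power:
  "(\<Prod>i\<in>I. qvar i ^ f i) = Poly_Mapping.single (\<Sum>i\<in>I. Poly_Mapping.single i (f i)) 1"
  by (induction I rule: infinite_finite_induct) (simp_all add: qvar_power mult_single)

lemma lookup_label_exponent:
  "Poly_Mapping.lookup (label_exponent n x T) i = (if i \<in> {1..n} then T (x i) else 0)"
  by (simp add: label_exponent_def lookup_sum lookup_single when_def)

lemma label_exponent_add_eq_iff:
  "label_exponent n x T + label_exponent n x U = m \<longleftrightarrow>
     (\<forall>i\<in>{1..n}. T (x i) + U (x i) = Poly_Mapping.lookup m i) \<and>
     (\<forall>i. i \<notin> {1..n} \<longrightarrow> Poly_Mapping.lookup m i = 0)"
  by (auto simp: poly_mapping_eq_iff fun_eq_iff lookup_add lookup_label_exponent)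

lemma lookup_Omega_q_mult:
  assumes X: "finite X"
  shows "Poly_Mapping.lookup (Omega_q X prec n x s * Omega_q X prec n x s') m =
    of_nat (card {(T, U) \<in> PP X prec s \<times> PP X prec s'.
      label_exponent n x T + label_exponent n x U = m})"
proof -
  have Omega: "Omega_q X prec n x k = (\<Sum>T\<in>PP X prec k. Poly_Mapping.single (label_exponent n x T) 1)"
    for k by (simp add: Omega_q_def prod_qvar_power label_exponent_def)
  have "Omega_q X prec n x s * Omega_q X prec n x s' =
    (\<Sum>(T, U)\<in>PP X prec s \<times> PP X prec s'.
      Poly_Mapping.single (label_exponent n x T + label_exponent n x U) 1)"
    by (simp add: Omega sum_product sum.cartesian_product mult_single)
  then have "Poly_Mapping.lookup (Omega_q X prec n x s * Omega_q X prec n x s') m =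
    (\<Sum>(T, U)\<in>PP X prec s \<times> PP X prec s'.
      of_bool (label_exponent n x T + label_exponent n x U = m))"
    by (auto simp: lookup_sum lookup_single when_def split_def intro!: sum.cong)
  also have "\<dots> = of_nat (card {(T, U) \<in> PP X prec s \<times> PP X prec s'.
      label_exponent n x T + label_exponent n x U = m})"
    using X by (simp add: split_def finite_PP Int_def mem_Times_iff conj_assoc)
  finally show ?thesis .
qed

text \<open>
  For an exponent vector \<open>m\<close> that involves only labels, the pairs counted by the coefficient are
  those with prescribed sum \<open>m\<close>, read as a map on \<open>X\<close>; for the other \<open>m\<close> there are none.
\<close>

lemma Omega_q_mult_coeff_ge:
  assumes x: "bij_betw x {1..n} X"
  shows "Omega_q X prec n x (t + a) * Omega_q X prec n x (t + b)
           \<ge>\<^sub>q Omega_q X prec n x t * Omega_q X prec n x (t + a + b)"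
  unfolding coeff_ge_def
proof
  fix m
  have X: "finite X" using x bij_betw_finite by blast
  define M :: "'a \<Rightarrow> nat" where "M y = Poly_Mapping.lookup m (the_inv_into {1..n} x y)" for y
  have M: "(\<forall>y\<in>X. T y + U y = M y) \<longleftrightarrow>
      (\<forall>i\<in>{1..n}. T (x i) + U (x i) = Poly_Mapping.lookup m i)" for T U
    using x by (auto simp: M_def bij_betw_def the_inv_into_f_f)
  have pairs: "{(T, U) \<in> PP X prec s \<times> PP X prec s'.
      label_exponent n x T + label_exponent n x U = m} =
    (if \<forall>i. i \<notin> {1..n} \<longrightarrow> Poly_Mapping.lookup m i = 0 then PP_pairs X prec M s s' else {})" for s s'
    unfolding label_exponent_add_eq_iff PP_pairs_def M by auto
  show "Poly_Mapping.lookup (Omega_q X prec n x (t + a) * Omega_q X prec n x (t + b)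
          - Omega_q X prec n x t * Omega_q X prec n x (t + a + b)) m \<ge> 0"
    using card_PP_pairs_le[OF X, of prec M t a b]
    by (simp only: lookup_minus lookup_Omega_q_mult[OF X] pairs) auto
qed

theorem corollary9p5:
  fixes X :: "'a set" and prec :: "'a \<Rightarrow> 'a \<Rightarrow> bool"
    and n :: nat and x :: "nat \<Rightarrow> 'a" and t :: nat
  assumes "finite_poset X prec"
    and "natural_labeling X prec n x"
    and "t \<ge> 1"
  shows "(Omega_q X prec n x t)\<^sup>2 \<ge>\<^sub>q Omega_q X prec n x (t - 1) * Omega_q X prec n x (t + 1) \<and>
         (\<forall>a\<ge>1. \<forall>b\<ge>1.
            Omega_q X prec n x (t + a) * Omega_q X prec n x (t + b)
              \<ge>\<^sub>q Omega_q X prec n x t * Omega_q X prec n x (t + a + b))"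
proof -
  have x: "bij_betw x {1..n} X"
    using assms(2) by (simp add: natural_labeling_def)
  have "(Omega_q X prec n x t)\<^sup>2 \<ge>\<^sub>q Omega_q X prec n x (t - 1) * Omega_q X prec n x (t + 1)"
    using Omega_q_mult_coeff_ge[OF x, of prec "t - 1" 1 1] assms(3)
    by (simp add: power2_eq_square)
  then show ?thesis
    using Omega_q_mult_coeff_ge[OF x] by blast
qed

end
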